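(* Let $A$ be a real reduced multiring. Let $\mathrm{Sper}(A)$ be the set of multiring morphisms $\sigma:A\to Q_2$, and for $a\in A$ let $\hat a:\mathrm{Sper}(A)\to\{-1,0,1\}$ be $\hat a(\sigma)=\sigma(a)$. Let $\hat A=\{\hat a:a\in A\}\subseteq\{-1,0,1\}^{\mathrm{Sper}(A)}$. Then $(\mathrm{Sper}(A),\hat A)$ is an abstract real spectrum.
   Context: A multiring is a tuple $(R,+,\cdot,-,0,1)$ with $+:R\times R\to\mathcal P(R)\setminus\{\emptyset\}$ satisfying: $z\in x+y\Rightarrow x\in z+(-y)$ and $y\in(-x)+z$; $y\in0+x\iff y=x$; $+$ associative (with $Z+w=\bigcup_{z\in Z}(z+w)$) and commutative; $(R,\cdot,1)$ a commutative monoid; $a0=0$; $c\in a+b\Rightarrow cd\in ad+bd$. A multiring $A$ is real reduced if $1\neq0$ and for all $a,b,c,d\in A$: $a^3=a$; $c\in a+ab^2\Rightarrow c=a$; $c,d\in a^2+b^2\Rightarrow c=d$. A multiring morphism $f$ satisfies $c\in a+b\Rightarrow f(c)\in f(a)+f(b)$, $f(-a)=-f(a)$, $f(0)=0$, $f(ab)=f(a)f(b)$, $f(1)=1$. $Q_2=\{-1,0,1\}$ is the multifield with usual product and sum $0+x=x+0=\{x\}$, $1+1=\{1\}$, $(-1)+(-1)=\{-1\}$, $1+(-1)=(-1)+1=\{-1,0,1\}$. An abstract real spectrum (ARS) is a pair $(X,G)$ such that: (AX1) $X$ is a non-empty set, $G$ is a submonoid of $\{-1,0,1\}^X$ (pointwise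 product) containing the constant functions $-1,0,1$, and $G$ separates points. For $a,b\in G$, $D(a,b)$ is the set of $c\in G$ with, for all $x$: $a(x)c(x)>0$ or $b(x)c(x)>0$ or $c(x)=0$; $D^t(a,b)$ is the set of $c\in G$ with, for all $x$: $a(x)c(x)>0$ or $b(x)c(x)>0$ or ($c(x)=0$ and $b(x)=-a(x)$). (AX2) If $P$ is a submonoid of $G$ with $P\cup-P=G$, $-1\notin P$, $a,b\in P\Rightarrow D(a,b)\subseteq P$, and $ab\in P\cap-P\Rightarrow a\in P\cap-P$ or $b\in P\cap-P$, then there is $x\in X$ with $P=\{a\in G:a(x)\ge0\}$. (AX3) If $p\in D^t(a,q)$ for some $q\in D^t(b,c)$, then $p\in D^t(r,c)$ for some $r\in D^t(a,b)$. *)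

theory Defs
  imports "HOL-Library.FuncSet"
begin

definition mr_addset :: "('a \<Rightarrow> 'a \<Rightarrow> 'a set) \<Rightarrow> 'a set \<Rightarrow> 'a \<Rightarrow> 'a set" where
  "mr_addset add Z w = (\<Union>z\<in>Z. add z w)"

definition multiring ::
  "('a \<Rightarrow> 'a \<Rightarrow> 'a set) \<Rightarrow> ('a \<Rightarrow> 'a \<Rightarrow> 'a) \<Rightarrow> ('a \<Rightarrow> 'a) \<Rightarrow> 'a \<Rightarrow> 'a \<Rightarrow> bool" where
  "multiring add mul neg zero one \<longleftrightarrow>
     (\<forall>x y. add x y \<noteq> {}) \<and>
     (\<forall>x y z. z \<in> add x y \<longrightarrow> x \<in> add z (neg y) \<and> y \<in> add (neg x) z) \<and>
     (\<forall>x y. y \<in> add zero x \<longleftrightarrow> y = x) \<and>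
     (\<forall>x y w. mr_addset add (add x y) w = mr_addset add (add y w) x) \<and>
     (\<forall>x y. add x y = add y x) \<and>
     (\<forall>x y z. mul (mul x y) z = mul x (mul y z)) \<and>
     (\<forall>x y. mul x y = mul y x) \<and>
     (\<forall>x. mul one x = x) \<and>
     (\<forall>a. mul a zero = zero) \<and>
     (\<forall>a b c d. c \<in> add a b \<longrightarrow> mul c d \<in> add (mul a d) (mul b d))"

definition real_reduced ::
  "('a \<Rightarrow> 'a \<Rightarrow> 'a set) \<Rightarrow> ('a \<Rightarrow> 'a \<Rightarrow> 'a) \<Rightarrow> ('a \<Rightarrow> 'a) \<Rightarrow> 'a \<Rightarrow> 'a \<Rightarrow> bool" where
  "real_reduced add mul neg zero one \<longleftrightarrow>
     multiring add mul neg zero one \<and> one \<noteq> zero \<and>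
     (\<forall>a. mul a (mul a a) = a) \<and>
     (\<forall>a b c. c \<in> add a (mul a (mul b b)) \<longrightarrow> c = a) \<and>
     (\<forall>a b c d. c \<in> add (mul a a) (mul b b) \<and> d \<in> add (mul a a) (mul b b) \<longrightarrow> c = d)"

definition q2_add :: "int \<Rightarrow> int \<Rightarrow> int set" where
  "q2_add x y = (if x = 0 then {y} else if y = 0 then {x}
                 else if x = y then {x} else {-1, 0, 1})"

definition Sper ::
  "('a \<Rightarrow> 'a \<Rightarrow> 'a set) \<Rightarrow> ('a \<Rightarrow> 'a \<Rightarrow> 'a) \<Rightarrow> ('a \<Rightarrow> 'a) \<Rightarrow> 'a \<Rightarrow> 'a \<Rightarrow> ('a \<Rightarrow> int) set" where
  "Sper add mul neg zero one =
     {\<sigma>. (\<forall>a. \<sigma> a \<in> {-1, 0, 1}) \<and>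
         (\<forall>a b c. c \<in> add a b \<longrightarrow> \<sigma> c \<in> q2_add (\<sigma> a) (\<sigma> b)) \<and>
         (\<forall>a. \<sigma> (neg a) = - \<sigma> a) \<and>
         \<sigma> zero = 0 \<and>
         (\<forall>a b. \<sigma> (mul a b) = \<sigma> a * \<sigma> b) \<and>
         \<sigma> one = 1}"

definition hat ::
  "('a \<Rightarrow> 'a \<Rightarrow> 'a set) \<Rightarrow> ('a \<Rightarrow> 'a \<Rightarrow> 'a) \<Rightarrow> ('a \<Rightarrow> 'a) \<Rightarrow> 'a \<Rightarrow> 'a \<Rightarrow> 'a \<Rightarrow> (('a \<Rightarrow> int) \<Rightarrow> int)" where
  "hat add mul neg zero one a = (\<lambda>\<sigma>\<in>Sper add mul neg zero one. \<sigma> a)"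

section \<open>Abstract real spectra; functions X \<rightarrow> {-1,0,1} are extensional (undefined off X)\<close>

definition ars_const :: "'x set \<Rightarrow> int \<Rightarrow> ('x \<Rightarrow> int)" where
  "ars_const X k = (\<lambda>x\<in>X. k)"

definition ars_mult :: "'x set \<Rightarrow> ('x \<Rightarrow> int) \<Rightarrow> ('x \<Rightarrow> int) \<Rightarrow> ('x \<Rightarrow> int)" where
  "ars_mult X f g = (\<lambda>x\<in>X. f x * g x)"

definition ars_neg :: "'x set \<Rightarrow> ('x \<Rightarrow> int) \<Rightarrow> ('x \<Rightarrow> int)" where
  "ars_neg X f = (\<lambda>x\<in>X. - f x)"

definition ars_D :: "'x set \<Rightarrow> ('x \<Rightarrow> int) set \<Rightarrow> ('x \<Rightarrow> int) \<Rightarrow> ('x \<Rightarrow> int) \<Rightarrow> ('x \<Rightarrow> int) set" where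
  "ars_D X G a b = {c\<in>G. \<forall>x\<in>X. a x * c x > 0 \<or> b x * c x > 0 \<or> c x = 0}"

definition ars_Dt :: "'x set \<Rightarrow> ('x \<Rightarrow> int) set \<Rightarrow> ('x \<Rightarrow> int) \<Rightarrow> ('x \<Rightarrow> int) \<Rightarrow> ('x \<Rightarrow> int) set" where
  "ars_Dt X G a b = {c\<in>G. \<forall>x\<in>X. a x * c x > 0 \<or> b x * c x > 0 \<or> (c x = 0 \<and> b x = - a x)}"

definition ARS :: "'x set \<Rightarrow> ('x \<Rightarrow> int) set \<Rightarrow> bool" where
  "ARS X G \<longleftrightarrow>
    \<comment> \<open>AX1\<close>
    X \<noteq> {} \<and> G \<subseteq> (X \<rightarrow>\<^sub>E {-1, 0, 1}) \<and>
    (\<forall>a\<in>G. \<forall>b\<in>G. ars_mult X a b \<in> G) \<and>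
    ars_const X (-1) \<in> G \<and> ars_const X 0 \<in> G \<and> ars_const X 1 \<in> G \<and>
    (\<forall>x\<in>X. \<forall>y\<in>X. x \<noteq> y \<longrightarrow> (\<exists>g\<in>G. g x \<noteq> g y)) \<and>
    \<comment> \<open>AX2\<close>
    (\<forall>P. P \<subseteq> G \<and> ars_const X 1 \<in> P \<and> (\<forall>a\<in>P. \<forall>b\<in>P. ars_mult X a b \<in> P) \<and>
         P \<union> ars_neg X ` P = G \<and> ars_const X (-1) \<notin> P \<and>
         (\<forall>a\<in>P. \<forall>b\<in>P. ars_D X G a b \<subseteq> P) \<and>
         (\<forall>a\<in>G. \<forall>b\<in>G. ars_mult X a b \<in> P \<inter> ars_neg X ` P \<longrightarrow>
              a \<in> P \<inter> ars_neg X ` P \<or> b \<in> P \<inter> ars_neg X ` P)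
       \<longrightarrow> (\<exists>x\<in>X. P = {a\<in>G. a x \<ge> 0})) \<and>
    \<comment> \<open>AX3\<close>
    (\<forall>a\<in>G. \<forall>b\<in>G. \<forall>c\<in>G. \<forall>p\<in>G.
       (\<exists>q\<in>ars_Dt X G b c. p \<in> ars_Dt X G a q) \<longrightarrow>
       (\<exists>r\<in>ars_Dt X G a b. p \<in> ars_Dt X G r c))"

end

theory Submission
  imports Defs
begin

text \<open>The heart of the matter is that the sum of a real reduced multiring \<open>A\<close> is determined by its
  orderings: \<open>c \<in> a + b\<close> if and only if \<open>\<sigma>(c) \<in> \<sigma>(a) + \<sigma>(b)\<close> for every morphism
  \<open>\<sigma> : A \<rightarrow> Q\<^sub>2\<close>; (AX3) is then associativity, and (AX2) says that orderings are morphisms to \<open>Q\<^sub>2\<close>.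
  By Zorn's lemma a preordering not containing \<open>-z\<^sup>2\<close> extends to an ordering \<open>\<sigma>\<close> with
  \<open>\<sigma>(z) \<noteq> 0\<close>, and since the squares of \<open>A\<close> are closed under addition, with single-valued sums, the
  orderings separate the points of \<open>A\<close>. If \<open>c\<close> has the sign of \<open>a\<close> or of \<open>b\<close> wherever it does not vanish,
  the extension principle gives \<open>c \<in> as + bt\<close> with squares \<open>s, t\<close>. Adding this relation
  to the corresponding ones for \<open>a \<in> c - b\<close> and \<open>b \<in> c - a\<close> absorbs the square
  coefficients, because \<open>x + xs = {x}\<close>.\<close>

section \<open>Arithmetic of multivalued sums\<close>

locale multiring_structure =
  fixes add :: "'a \<Rightarrow> 'a \<Rightarrow> 'a set" (infixl "\<oplus>" 65)
    and mul :: "'a \<Rightarrow> 'a \<Rightarrow> 'a" (infixl "\<otimes>" 70)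
    and neg :: "'a \<Rightarrow> 'a"
    and zero one :: 'a
  assumes mr: "multiring add mul neg zero one"
begin

lemma add_nonempty: "\<exists>z. z \<in> x \<oplus> y"
  using mr unfolding multiring_def by (metis ex_in_conv)

lemma add_comm: "x \<oplus> y = y \<oplus> x"
  using mr unfolding multiring_def by blast

lemma add_zero_iff [simp]: "y \<in> zero \<oplus> x \<longleftrightarrow> y = x" "y \<in> x \<oplus> zero \<longleftrightarrow> y = x"
  using mr add_comm unfolding multiring_def by auto

lemma mul_assoc: "x \<otimes> y \<otimes> z = x \<otimes> (y \<otimes> z)"
  using mr unfolding multiring_def by blast

lemma mul_comm: "x \<otimes> y = y \<otimes> x"
  using mr unfolding multiring_def by blast

lemma mul_left_comm: "x \<otimes> (y \<otimes> z) = y \<otimes> (x \<otimes> z)"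
  by (metis mul_assoc mul_comm)

lemmas mul_ac = mul_assoc mul_comm mul_left_comm

lemma mul_one [simp]: "one \<otimes> x = x" "x \<otimes> one = x"
  using mr mul_comm unfolding multiring_def by metis+

lemma mul_zero [simp]: "zero \<otimes> x = zero" "x \<otimes> zero = zero"
  using mr mul_comm unfolding multiring_def by metis+

lemma mul_add: "c \<in> a \<oplus> b \<Longrightarrow> c \<otimes> d \<in> a \<otimes> d \<oplus> b \<otimes> d"
  using mr unfolding multiring_def by blast

lemma mul_add_left: "c \<in> a \<oplus> b \<Longrightarrow> d \<otimes> c \<in> d \<otimes> a \<oplus> d \<otimes> b"
  using mul_add mul_comm by metis

lemma add_shift: "z \<in> x \<oplus> y \<Longrightarrow> x \<in> z \<oplus> neg y"
  using mr unfolding multiring_def by meson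

lemma add_shift_left: "z \<in> x \<oplus> y \<Longrightarrow> y \<in> z \<oplus> neg x"
  using add_shift add_comm by metis

lemma zero_in_add_neg: "zero \<in> x \<oplus> neg x"
  by (rule add_shift) simp

lemma neg_unique: "zero \<in> x \<oplus> y \<Longrightarrow> y = neg x"
  using add_shift_left by fastforce

lemma neg_neg [simp]: "neg (neg x) = x"
  by (metis neg_unique zero_in_add_neg add_comm)

lemma neg_eq_iff [simp]: "neg x = neg y \<longleftrightarrow> x = y"
  by (metis neg_neg)

lemma neg_zero [simp]: "neg zero = zero"
  using zero_in_add_neg[of zero] by simp

lemma neg_mul [simp]: "neg a \<otimes> b = neg (a \<otimes> b)" "b \<otimes> neg a = neg (b \<otimes> a)"
proof -
  show *: "neg a \<otimes> b = neg (a \<otimes> b)" for a b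
    using mul_add[OF zero_in_add_neg[of a], of b] neg_unique by simp
  show "b \<otimes> neg a = neg (b \<otimes> a)"
    using * mul_comm by metis
qed

lemma neg_add: "z \<in> x \<oplus> y \<Longrightarrow> neg z \<in> neg x \<oplus> neg y"
  using mul_add[of z x y "neg one"] by simp

lemma add_shift_iff: "z \<in> x \<oplus> neg y \<longleftrightarrow> x \<in> z \<oplus> y"
  using add_shift[of z x "neg y"] add_shift[of x z y] by auto

text \<open>The axiom has the cyclic shape (x + y) + w = (y + w) + x; commutativity turns it into
  associativity, with the intermediate sum \<open>q\<close> as a witness.\<close>

lemma add_assoc_right: "p \<in> x \<oplus> y \<Longrightarrow> r \<in> p \<oplus> w \<Longrightarrow> \<exists>q \<in> y \<oplus> w. r \<in> x \<oplus> q"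
proof -
  assume "p \<in> x \<oplus> y" "r \<in> p \<oplus> w"
  then have "r \<in> mr_addset add (x \<oplus> y) w"
    unfolding mr_addset_def by blast
  then have "r \<in> mr_addset add (y \<oplus> w) x"
    using mr unfolding multiring_def by blast
  then show ?thesis
    unfolding mr_addset_def using add_comm by blast
qed

lemma add_assoc_left: "q \<in> y \<oplus> w \<Longrightarrow> r \<in> x \<oplus> q \<Longrightarrow> \<exists>p \<in> x \<oplus> y. r \<in> p \<oplus> w"
  using add_assoc_right[of q w y r x] by (auto simp: add_comm[of x] add_comm[of w])

lemma add_interchange:
  assumes "p \<in> x \<oplus> y" "q \<in> z \<oplus> w" "r \<in> p \<oplus> q"
  shows "\<exists>u \<in> x \<oplus> z. \<exists>v \<in> y \<oplus> w. r \<in> u \<oplus> v"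
proof -
  obtain k where k: "k \<in> y \<oplus> q" "r \<in> x \<oplus> k"
    using add_assoc_right assms by blast
  obtain l where l: "l \<in> y \<oplus> w" "k \<in> z \<oplus> l"
    using add_assoc_right[of q z w k y] assms(2) k(1) by (auto simp: add_comm[of y])
  show ?thesis
    using add_assoc_left[OF l(2) k(2)] l(1) by blast
qed

text \<open>Products distribute over sums only as an inclusion, so pq merely lies in the expansion.
  Pairing ac with bd and bc with ad suits factors of the form "element of a preordering plus
  multiple of x": the first pair falls back into the preordering, the second stays among the
  multiples of x.\<close>

lemma mul_add_add:
  assumes "p \<in> a \<oplus> b" "q \<in> c \<oplus> d"
  shows "\<exists>u \<in> a \<otimes> c \<oplus> b \<otimes> d. \<exists>v \<in> b \<otimes> c \<oplus> a \<otimes> d. p \<otimes> q \<in> u \<oplus> v"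
proof -
  have 1: "p \<otimes> q \<in> p \<otimes> c \<oplus> p \<otimes> d"
    using mul_add_left[OF assms(2)] .
  have 2: "p \<otimes> c \<in> a \<otimes> c \<oplus> b \<otimes> c" "p \<otimes> d \<in> b \<otimes> d \<oplus> a \<otimes> d"
    using mul_add[OF assms(1)] add_comm by metis+
  show ?thesis
    using add_interchange[OF 2 1] .
qed

section \<open>Orderings as morphisms to Q_2\<close>

abbreviation "spec \<equiv> Sper add mul neg zero one"

lemma Sper_values: "\<sigma> \<in> spec \<Longrightarrow> \<sigma> a = -1 \<or> \<sigma> a = 0 \<or> \<sigma> a = 1"
  unfolding Sper_def by auto

lemma Sper_add: "\<sigma> \<in> spec \<Longrightarrow> c \<in> a \<oplus> b \<Longrightarrow> \<sigma> c \<in> q2_add (\<sigma> a) (\<sigma> b)"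
  unfolding Sper_def by auto

lemma Sper_hom [simp]:
  assumes "\<sigma> \<in> spec"
  shows "\<sigma> (neg a) = - \<sigma> a" "\<sigma> zero = 0" "\<sigma> (a \<otimes> b) = \<sigma> a * \<sigma> b" "\<sigma> one = 1"
  using assms unfolding Sper_def by auto

text \<open>The morphism is the sign relative to \<open>T\<close>, with T meet -T as its set of
  zeros. It serves twice: for the maximal preordering in the Positivstellensatz and for the set P of
  (AX2).\<close>

lemma ordering_morphism:
  assumes mulT: "\<And>s t. s \<in> T \<Longrightarrow> t \<in> T \<Longrightarrow> s \<otimes> t \<in> T"
    and addT: "\<And>s t. s \<in> T \<Longrightarrow> t \<in> T \<Longrightarrow> s \<oplus> t \<subseteq> T"
    and total: "\<And>x. x \<in> T \<or> neg x \<in> T"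
    and proper: "neg one \<notin> T"
    and prime: "\<And>x y. x \<otimes> y \<in> T \<Longrightarrow> neg (x \<otimes> y) \<in> T \<Longrightarrow>
      x \<in> T \<and> neg x \<in> T \<or> y \<in> T \<and> neg y \<in> T"
  shows "\<exists>\<sigma> \<in> spec. \<forall>a. \<sigma> a \<ge> 0 \<longleftrightarrow> a \<in> T"
proof -
  define \<sigma> :: "'a \<Rightarrow> int" where
    "\<sigma> a = (if a \<notin> T then -1 else if neg a \<in> T then 0 else 1)" for a
  have oneT: "one \<in> T"
    using total proper by blast
  have zeroT: "zero \<in> T"
    using total[of zero] by simp
  \<comment> \<open>A strictly positive summand cannot be cancelled: if -c were in \<open>T\<close>,
    then -a, which lies in -c + b, would be too.\<close>
  have strict: "neg c \<notin> T" if "c \<in> a \<oplus> b" "neg a \<notin> T" "b \<in> T" for a b c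
  proof
    assume "neg c \<in> T"
    moreover have "neg a \<in> neg c \<oplus> b"
      using neg_add[OF add_shift[OF that(1)]] by simp
    ultimately show False
      using addT that by blast
  qed
  have sgn_neg: "\<sigma> (neg a) = - \<sigma> a" for a
    using total[of a] by (auto simp: \<sigma>_def)
  have pos: "\<sigma> c = 1" if "c \<in> a \<oplus> b" "\<sigma> a = 1" "\<sigma> b \<ge> 0" for a b c
    using that strict[of c a b] addT[of a b] by (auto simp: \<sigma>_def split: if_splits)
  have null: "\<sigma> c = 0" if "c \<in> a \<oplus> b" "\<sigma> a = 0" "\<sigma> b = 0" for a b c
    using that neg_add[OF that(1)] addT[of a b] addT[of "neg a" "neg b"]
    by (auto simp: \<sigma>_def split: if_splits)
  have vals: "\<sigma> a = -1 \<or> \<sigma> a = 0 \<or> \<sigma> a = 1" for a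
    by (auto simp: \<sigma>_def)
  \<comment> \<open>Negation and commutativity reduce every case to \<open>pos\<close> or
    \<open>null\<close>, except opposite nonzero signs, where \<open>q2_add\<close> is all of {-1,
    0, 1}.\<close>
  have sum: "\<sigma> c \<in> q2_add (\<sigma> a) (\<sigma> b)" if c: "c \<in> a \<oplus> b" for a b c
    using pos[OF c] pos[of c b a] null[OF c] c add_comm[of a b]
      pos[OF neg_add[OF c]] pos[of "neg c" "neg b" "neg a"] neg_add[OF c] add_comm[of "neg a" "neg b"]
      vals[of a] vals[of b] vals[of c]
    unfolding q2_add_def sgn_neg by auto
  have posmul: "\<sigma> (a \<otimes> b) = \<sigma> a * \<sigma> b" if "\<sigma> a \<ge> 0" "\<sigma> b \<ge> 0" for a b
  proof -
    have ab: "a \<in> T" "b \<in> T"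
      using that by (auto simp: \<sigma>_def split: if_splits)
    \<comment> \<open>If -a or -b is in \<open>T\<close>, then so are both ab and -ab, and the
      product has sign 0. Otherwise \<open>prime\<close> keeps -ab out of \<open>T\<close>.\<close>
    show ?thesis
      using mulT[OF ab] mulT[of "neg a" b] mulT[of a "neg b"] prime[of a b] ab
      by (auto simp: \<sigma>_def)
  qed
  have prod: "\<sigma> (a \<otimes> b) = \<sigma> a * \<sigma> b" for a b
    using posmul[of a b] posmul[of "neg a" b] posmul[of a "neg b"] posmul[of "neg a" "neg b"]
    by (cases "\<sigma> a \<ge> 0"; cases "\<sigma> b \<ge> 0") (auto simp: sgn_neg)
  have "\<sigma> \<in> spec"
    unfolding Sper_def using vals sum sgn_neg prod oneT zeroT proper
    by (auto simp: \<sigma>_def[of zero] \<sigma>_def[of one])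
  then show ?thesis
    by (intro bexI[of _ \<sigma>]) (auto simp: \<sigma>_def)
qed

section \<open>Preorderings and the adjunction of an element\<close>

definition preordering :: "'a set \<Rightarrow> bool" where
  "preordering T \<longleftrightarrow> (\<forall>a. a \<otimes> a \<in> T) \<and> (\<forall>s\<in>T. \<forall>t\<in>T. s \<otimes> t \<in> T \<and> s \<oplus> t \<subseteq> T)"

lemma preorderingD:
  assumes "preordering T"
  shows "a \<otimes> a \<in> T" "s \<in> T \<Longrightarrow> t \<in> T \<Longrightarrow> s \<otimes> t \<in> T"
    "s \<in> T \<Longrightarrow> t \<in> T \<Longrightarrow> z \<in> s \<oplus> t \<Longrightarrow> z \<in> T" "zero \<in> T" "one \<in> T"
proof -
  show "a \<otimes> a \<in> T" for a
    using assms by (auto simp: preordering_def)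
  from this[of zero] this[of one] show "zero \<in> T" "one \<in> T"
    by simp_all
qed (use assms in \<open>auto simp: preordering_def\<close>)

text \<open>In a multiring \<open>x \<otimes> s \<oplus> x \<otimes> t\<close> may exceed \<open>x \<otimes> (s \<oplus> t)\<close>, so adjoining \<open>x\<close> to a
  preordering requires closing the multiples of \<open>x\<close> under addition.\<close>

inductive_set cone :: "'a set \<Rightarrow> 'a \<Rightarrow> 'a set" for T x where
  mult: "t \<in> T \<Longrightarrow> x \<otimes> t \<in> cone T x"
| sum: "v \<in> cone T x \<Longrightarrow> w \<in> cone T x \<Longrightarrow> z \<in> v \<oplus> w \<Longrightarrow> z \<in> cone T x"

definition adjoin :: "'a set \<Rightarrow> 'a \<Rightarrow> 'a set" where
  "adjoin T x = {z. \<exists>s\<in>T. \<exists>w\<in>cone T x. z \<in> s \<oplus> w}"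

lemma cone_mul_closed:
  assumes "w \<in> cone T x" "\<And>t. t \<in> T \<Longrightarrow> x \<otimes> t \<otimes> y \<in> S"
    "\<And>u v z. u \<in> S \<Longrightarrow> v \<in> S \<Longrightarrow> z \<in> u \<oplus> v \<Longrightarrow> z \<in> S"
  shows "w \<otimes> y \<in> S"
  using assms(1)
proof induction
  case (mult t)
  then show ?case
    using assms(2) by blast
next
  case (sum v w z)
  then show ?case
    using assms(3) mul_add by blast
qed

lemma cone_mul_preordering:
  assumes "preordering T" "w \<in> cone T x" "t \<in> T"
  shows "w \<otimes> t \<in> cone T x"
proof (rule cone_mul_closed[OF assms(2)])
  fix s assume "s \<in> T"
  then show "x \<otimes> s \<otimes> t \<in> cone T x"
    using assms by (auto simp: mul_assoc intro!: cone.mult preorderingD(2))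
qed (rule cone.sum)

text \<open>Both cones are generated under addition by multiples of x and of y, so two inductions
  leave only the products xyt. The target \<open>S\<close> is kept free: it is \<open>T\<close>
  itself when x = y, and the set of negatives of \<open>T\<close> in the Positivstellensatz.\<close>

lemma cone_mul_cone:
  assumes T: "preordering T" and "w \<in> cone T x" "v \<in> cone T y"
    and S: "\<And>t. t \<in> T \<Longrightarrow> x \<otimes> y \<otimes> t \<in> S"
    "\<And>u v z. u \<in> S \<Longrightarrow> v \<in> S \<Longrightarrow> z \<in> u \<oplus> v \<Longrightarrow> z \<in> S"
  shows "w \<otimes> v \<in> S"
proof (rule cone_mul_closed[OF assms(2)])
  fix t assume t: "t \<in> T"
  have "v \<otimes> (x \<otimes> t) \<in> S"
  proof (rule cone_mul_closed[OF assms(3)])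
    fix s assume "s \<in> T"
    then have "x \<otimes> y \<otimes> (s \<otimes> t) \<in> S"
      using t S(1) preorderingD(2)[OF T] by blast
    then show "y \<otimes> s \<otimes> (x \<otimes> t) \<in> S"
      by (simp add: mul_ac)
  qed (rule S(2))
  then show "x \<otimes> t \<otimes> v \<in> S"
    by (simp add: mul_comm)
qed (rule S(2))

text \<open>In (s + w)(s' + w') the term ww' lies in \<open>T\<close> because x^2 does, and the
  cross terms lie in the cone.\<close>

lemma adjoin_preordering:
  assumes T: "preordering T"
  shows "preordering (adjoin T x)" "T \<subseteq> adjoin T x" "x \<in> adjoin T x"
proof -
  have zero_cone: "zero \<in> cone T x"
    using cone.mult[OF preorderingD(4)[OF T], of x] by simp
  then show sub: "T \<subseteq> adjoin T x"
    unfolding adjoin_def by force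
  have "x \<in> cone T x"
    using cone.mult[OF preorderingD(5)[OF T], of x] by simp
  then show "x \<in> adjoin T x"
    unfolding adjoin_def using preorderingD(4)[OF T] by force
  have "p \<otimes> q \<in> adjoin T x \<and> p \<oplus> q \<subseteq> adjoin T x" if pq: "p \<in> adjoin T x" "q \<in> adjoin T x" for p q
  proof -
    obtain s w s' w' where p: "s \<in> T" "w \<in> cone T x" "p \<in> s \<oplus> w"
      and q: "s' \<in> T" "w' \<in> cone T x" "q \<in> s' \<oplus> w'"
      using pq unfolding adjoin_def by blast
    have "p \<oplus> q \<subseteq> adjoin T x"
    proof
      fix r assume "r \<in> p \<oplus> q"
      then show "r \<in> adjoin T x"
        using add_interchange[OF p(3) q(3)] preorderingD(3)[OF T p(1) q(1)] cone.sum[OF p(2) q(2)]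
        unfolding adjoin_def by blast
    qed
    moreover obtain u v where uv: "u \<in> s \<otimes> s' \<oplus> w \<otimes> w'" "v \<in> w \<otimes> s' \<oplus> s \<otimes> w'" "p \<otimes> q \<in> u \<oplus> v"
      using mul_add_add[OF p(3) q(3)] by blast
    have "w \<otimes> w' \<in> T"
      using cone_mul_cone[OF T p(2) q(2)] preorderingD[OF T] by blast
    then have "u \<in> T"
      using uv(1) p q preorderingD[OF T] by blast
    moreover have "v \<in> cone T x"
      using uv(2) cone.sum cone_mul_preordering[OF T] p q mul_comm by metis
    ultimately show ?thesis
      using uv(3) unfolding adjoin_def by blast
  qed
  then show "preordering (adjoin T x)"
    unfolding preordering_def using sub preorderingD(1)[OF T] by blast
qed

lemma maximal_preordering:
  assumes "preordering T0" "e \<notin> T0"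
  obtains T where "preordering T" "T0 \<subseteq> T" "e \<notin> T"
    "\<And>U. preordering U \<Longrightarrow> T \<subseteq> U \<Longrightarrow> e \<notin> U \<Longrightarrow> U = T"
proof -
  let ?\<A> = "{T. preordering T \<and> T0 \<subseteq> T \<and> e \<notin> T}"
  have "\<exists>M\<in>?\<A>. \<forall>X\<in>?\<A>. M \<subseteq> X \<longrightarrow> X = M"
  proof (rule subset_Zorn)
    fix \<C> assume chain: "subset.chain ?\<A> \<C>"
    show "\<exists>U\<in>?\<A>. \<forall>X\<in>\<C>. X \<subseteq> U"
    proof (cases "\<C> = {}")
      case True
      then show ?thesis
        using assms by auto
    next
      case False
      have mem: "preordering X" "T0 \<subseteq> X" "e \<notin> X" if "X \<in> \<C>" for X
        using chain that unfolding subset.chain_def by auto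
      have pair: "\<exists>X\<in>\<C>. s \<in> X \<and> t \<in> X" if "s \<in> \<Union>\<C>" "t \<in> \<Union>\<C>" for s t
        using chain that unfolding subset_chain_def by blast
      have "preordering (\<Union>\<C>)"
        unfolding preordering_def
      proof (intro conjI allI ballI)
        show "a \<otimes> a \<in> \<Union>\<C>" for a
          using False mem(1) preorderingD(1) by blast
        fix s t assume "s \<in> \<Union>\<C>" "t \<in> \<Union>\<C>"
        then obtain X where X: "X \<in> \<C>" "s \<in> X" "t \<in> X"
          using pair by blast
        then show "s \<otimes> t \<in> \<Union>\<C>" "s \<oplus> t \<subseteq> \<Union>\<C>"
          using mem(1)[OF X(1)] unfolding preordering_def by blast+
      qed
      then show ?thesis
        using False mem(2,3) by (intro bexI[of _ "\<Union>\<C>"]) auto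
    qed
  qed
  then obtain T where "T \<in> ?\<A>" "\<forall>X\<in>?\<A>. T \<subseteq> X \<longrightarrow> X = T"
    by blast
  then show ?thesis
    by (intro that[of T]) auto
qed

end

section \<open>Real reduced multirings and the Positivstellensatz\<close>

locale real_reduced_multiring =
  fixes add :: "'a \<Rightarrow> 'a \<Rightarrow> 'a set" (infixl "\<oplus>" 65)
    and mul :: "'a \<Rightarrow> 'a \<Rightarrow> 'a" (infixl "\<otimes>" 70)
    and neg :: "'a \<Rightarrow> 'a"
    and zero one :: 'a
  assumes rr: "real_reduced add mul neg zero one"

sublocale real_reduced_multiring \<subseteq> multiring_structure
  using rr by unfold_locales (simp add: real_reduced_def)

context real_reduced_multiring
begin

lemma cube [simp]: "a \<otimes> (a \<otimes> a) = a"
  using rr by (simp add: real_reduced_def)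

lemma absorb_square: "c \<in> a \<oplus> a \<otimes> (b \<otimes> b) \<Longrightarrow> c = a"
  using rr by (simp add: real_reduced_def)

lemma squares_sum_unique: "c \<in> a \<otimes> a \<oplus> b \<otimes> b \<Longrightarrow> d \<in> a \<otimes> a \<oplus> b \<otimes> b \<Longrightarrow> c = d"
  using rr unfolding real_reduced_def by meson

lemma cube_mul [simp]: "a \<otimes> (a \<otimes> (a \<otimes> b)) = a \<otimes> b"
  using arg_cong[OF cube[of a], of "\<lambda>x. x \<otimes> b"] unfolding mul_assoc .

text \<open>Maximality is taken among preorderings omitting -z^2 rather than -1, which makes z
  nonzero at the resulting ordering. Totality and primeness of the maximal preordering both come
  from \<open>key\<close>: totality is the case y = -x, where the hypothesis reads that x^2 lies in
  \<open>T\<close>.\<close>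

theorem positivstellensatz:
  assumes T0: "preordering T0" and z: "neg (z \<otimes> z) \<notin> T0"
  shows "\<exists>\<sigma>\<in>spec. (\<forall>t\<in>T0. \<sigma> t \<ge> 0) \<and> \<sigma> z \<noteq> 0"
proof -
  obtain T where T: "preordering T" and sub: "T0 \<subseteq> T" and zT: "neg (z \<otimes> z) \<notin> T"
    and max: "\<And>U. preordering U \<Longrightarrow> T \<subseteq> U \<Longrightarrow> neg (z \<otimes> z) \<notin> U \<Longrightarrow> U = T"
    by (rule maximal_preordering[OF T0 z]) blast
  note TD = preorderingD[OF T]
  have key: "x \<in> T \<or> y \<in> T" if xy: "neg (x \<otimes> y) \<in> T" for x y
  proof (rule ccontr)
    assume "\<not> (x \<in> T \<or> y \<in> T)"
    then have "neg (z \<otimes> z) \<in> adjoin T x" "neg (z \<otimes> z) \<in> adjoin T y"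
      using max adjoin_preordering[OF T] by metis+
    then obtain s w s' w' where p: "s \<in> T" "w \<in> cone T x" "neg (z \<otimes> z) \<in> s \<oplus> w"
      and q: "s' \<in> T" "w' \<in> cone T y" "neg (z \<otimes> z) \<in> s' \<oplus> w'"
      unfolding adjoin_def by blast
    \<comment> \<open>Multiplying these two relations, ww' lies in ss' + z^4 plus cross terms in
      \<open>T\<close>, while -xy in \<open>T\<close> makes ww' the negative of an element of
      \<open>T\<close>. As z^4 = z^2, solving for -z^2 puts it in \<open>T\<close>.\<close>
    have w: "neg w \<in> s \<oplus> z \<otimes> z" "neg w' \<in> s' \<oplus> z \<otimes> z"
      using neg_add[OF add_shift_left[OF p(3)]] neg_add[OF add_shift_left[OF q(3)]]
      by (simp_all add: add_comm)
    have ww: "w \<otimes> w' \<in> neg ` T"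
    proof (rule cone_mul_cone[OF T p(2) q(2)])
      fix t assume "t \<in> T"
      then have "neg (x \<otimes> y \<otimes> t) \<in> T"
        using TD(2)[OF xy] by simp
      then show "x \<otimes> y \<otimes> t \<in> neg ` T"
        by (metis image_eqI neg_neg)
    next
      fix u v c assume "u \<in> neg ` T" "v \<in> neg ` T" "c \<in> u \<oplus> v"
      then have "neg c \<in> T"
        using neg_add[of c u v] TD(3)[of "neg u" "neg v" "neg c"] by auto
      then show "c \<in> neg ` T"
        by (metis image_eqI neg_neg)
    qed
    then obtain t where t: "t \<in> T" "w \<otimes> w' = neg t"
      by blast
    obtain u v where uv: "u \<in> s \<otimes> s' \<oplus> z \<otimes> z \<otimes> (z \<otimes> z)"
        "v \<in> z \<otimes> z \<otimes> s' \<oplus> s \<otimes> (z \<otimes> z)" "w \<otimes> w' \<in> u \<oplus> v"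
      using mul_add_add[OF w] by auto
    have "v \<in> T"
      using uv(2) p(1) q(1) TD by blast
    moreover have "neg u \<in> t \<oplus> v"
      using neg_add[OF add_shift[OF uv(3)]] t(2) by simp
    ultimately have "neg u \<in> T"
      using t(1) TD(3) by blast
    moreover have "neg (z \<otimes> z) \<in> neg u \<oplus> s \<otimes> s'"
      using neg_add[OF add_shift_left[OF uv(1)]] by (simp add: mul_assoc)
    ultimately show False
      using TD(2)[OF p(1) q(1)] TD(3) zT by blast
  qed
  have total: "x \<in> T \<or> neg x \<in> T" for x
    using key[of x "neg x"] TD(1)[of x] by simp
  have prime: "x \<in> T \<and> neg x \<in> T \<or> y \<in> T \<and> neg y \<in> T"
    if "x \<otimes> y \<in> T" "neg (x \<otimes> y) \<in> T" for x y
    using that key[of x y] key[of x "neg y"] key[of "neg x" y] key[of "neg x" "neg y"] by auto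
  have proper: "neg one \<notin> T"
    using zT TD(2)[OF _ TD(1), of "neg one" z] by auto
  have "\<exists>\<sigma> \<in> spec. \<forall>a. \<sigma> a \<ge> 0 \<longleftrightarrow> a \<in> T"
  proof (rule ordering_morphism)
    show "s \<otimes> t \<in> T" "s \<oplus> t \<subseteq> T" if "s \<in> T" "t \<in> T" for s t
      using TD(2,3)[OF that] by auto
  qed (fact total proper prime)+
  then obtain \<sigma> where \<sigma>: "\<sigma> \<in> spec" "\<And>a. \<sigma> a \<ge> 0 \<longleftrightarrow> a \<in> T"
    by blast
  have "\<sigma> (neg (z \<otimes> z)) < 0"
    using \<sigma>(2)[of "neg (z \<otimes> z)"] zT by linarith
  then show ?thesis
    using \<sigma> sub by (intro bexI[of _ \<sigma>] conjI) (auto simp: Sper_hom[OF \<sigma>(1)])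
qed

section \<open>Squares and their sums\<close>

definition Sq :: "'a set" where
  "Sq = {e. e \<otimes> e = e}"

text \<open>From a^3 = a, every square is idempotent, and an idempotent is its own square. So
  \<open>Sq\<close> is exactly the set of squares, described without an existential
  quantifier.\<close>

lemma square_in_Sq: "a \<otimes> a \<in> Sq"
  by (simp add: Sq_def mul_assoc)

lemma zero_one_in_Sq: "zero \<in> Sq" "one \<in> Sq"
  by (simp_all add: Sq_def)

lemma Sq_idem: "e \<in> Sq \<Longrightarrow> e \<otimes> e = e"
  by (simp add: Sq_def)

lemma Sq_mul: "e \<in> Sq \<Longrightarrow> f \<in> Sq \<Longrightarrow> e \<otimes> f \<in> Sq"
proof -
  assume "e \<in> Sq" "f \<in> Sq"
  moreover have "e \<otimes> f \<otimes> (e \<otimes> f) = e \<otimes> e \<otimes> (f \<otimes> f)"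
    by (simp only: mul_ac)
  ultimately show ?thesis
    by (simp add: Sq_def)
qed

lemma Sq_absorb: "e \<in> Sq \<Longrightarrow> z \<in> a \<oplus> a \<otimes> e \<longleftrightarrow> z = a"
proof -
  assume "e \<in> Sq"
  then have "z = a" if "z \<in> a \<oplus> a \<otimes> e" for z
    using absorb_square[of z a e] that Sq_idem[of e] by simp
  then show ?thesis
    using add_nonempty[of a "a \<otimes> e"] by blast
qed

lemma add_self: "z \<in> a \<oplus> a \<longleftrightarrow> z = a"
  using Sq_absorb[OF zero_one_in_Sq(2)] by simp

lemma Sq_sum_unique: "e \<in> Sq \<Longrightarrow> f \<in> Sq \<Longrightarrow> y \<in> e \<oplus> f \<Longrightarrow> z \<in> e \<oplus> f \<Longrightarrow> y = z"
  using squares_sum_unique[of y e f z] Sq_idem[of e] Sq_idem[of f] by simp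

text \<open>Multiplying z in e + f by e gives ze in e + ef = {e}, and likewise zf = f. Then z^2 lies
  in ze + zf = e + f, and sums of squares are single-valued.\<close>

lemma Sq_add:
  assumes "e \<in> Sq" "f \<in> Sq" "z \<in> e \<oplus> f"
  shows "z \<in> Sq"
proof -
  have e: "z \<otimes> e = e"
    using mul_add[OF assms(3), of e] Sq_absorb[OF assms(2), of "z \<otimes> e" e] assms(1)
    by (simp add: Sq_idem mul_comm)
  have f: "z \<otimes> f = f"
    using mul_add[OF assms(3), of f] Sq_absorb[OF assms(1), of "z \<otimes> f" f] assms(2)
    by (simp add: Sq_idem mul_comm add_comm)
  have "z \<otimes> z \<in> e \<oplus> f"
    using mul_add_left[OF assms(3), of z] e f by simp
  then show ?thesis
    using Sq_sum_unique assms unfolding Sq_def by blast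
qed

lemma preordering_Sq: "preordering Sq"
  unfolding preordering_def using square_in_Sq Sq_mul Sq_add by blast

text \<open>For y in 1 + a, the square y^2 lies in (1 + a^2) + (a + a) = 1 + a. Since 1 + y^2 = {1},
  it follows that 1 lies in (1 + 1) + a = 1 + a.\<close>

lemma one_in_one_add: "one \<in> one \<oplus> a"
proof -
  obtain y where y: "y \<in> one \<oplus> a"
    using add_nonempty by blast
  obtain u v where uv: "u \<in> one \<otimes> one \<oplus> a \<otimes> a" "v \<in> a \<otimes> one \<oplus> one \<otimes> a" "y \<otimes> y \<in> u \<oplus> v"
    using mul_add_add[OF y y] by blast
  have "u = one"
    using Sq_absorb[OF square_in_Sq[of a], of u one] uv(1) by simp
  moreover have "v = a"
    using uv(2) by (simp add: add_self)
  ultimately have yy: "y \<otimes> y \<in> one \<oplus> a"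
    using uv(3) by simp
  have "one \<in> one \<oplus> y \<otimes> y"
    using Sq_absorb[OF square_in_Sq[of y], of one one] by simp
  then obtain p where "p \<in> one \<oplus> one" "one \<in> p \<oplus> a"
    using add_assoc_left[OF yy] by blast
  then show ?thesis
    by (simp add: add_self)
qed

lemma square_in_diff_self: "a \<otimes> a \<in> a \<oplus> neg a"
  using mul_add[OF add_shift_left[OF one_in_one_add[of a]], of a] by simp

section \<open>Orderings separate points\<close>

lemma Sper_Sq: "\<sigma> \<in> spec \<Longrightarrow> e \<in> Sq \<Longrightarrow> \<sigma> e = 0 \<or> \<sigma> e = 1"
  using Sper_hom(3)[of \<sigma> e e] Sper_values[of \<sigma> e] Sq_idem[of e] by auto

text \<open>No ordering makes -a nonnegative and a nonzero, so -a^2 lies in some s + w with w in the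
  cone of -a. Multiplying by a turns w into -t with t a square, whence t lies in a + as =
  {a}.\<close>

lemma nonneg_in_Sq:
  assumes "\<And>\<sigma>. \<sigma> \<in> spec \<Longrightarrow> \<sigma> a \<ge> 0"
  shows "a \<in> Sq"
proof -
  note A = adjoin_preordering[OF preordering_Sq, of "neg a"]
  have "neg (a \<otimes> a) \<in> adjoin Sq (neg a)"
  proof (rule ccontr)
    assume "\<not> ?thesis"
    then obtain \<sigma> where "\<sigma> \<in> spec" "\<sigma> (neg a) \<ge> 0" "\<sigma> a \<noteq> 0"
      using positivstellensatz[OF A(1)] A(3) by blast
    then show False
      using assms[of \<sigma>] by simp
  qed
  then obtain s w where s: "s \<in> Sq" "w \<in> cone Sq (neg a)" "neg (a \<otimes> a) \<in> s \<oplus> w"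
    unfolding adjoin_def by blast
  have "w \<otimes> a \<in> neg ` Sq"
  proof (rule cone_mul_closed[OF s(2)])
    fix t assume "t \<in> Sq"
    then have "a \<otimes> a \<otimes> t \<in> Sq"
      using square_in_Sq Sq_mul by blast
    moreover have "neg a \<otimes> t \<otimes> a = neg (a \<otimes> a \<otimes> t)"
      by (simp add: mul_ac)
    ultimately show "neg a \<otimes> t \<otimes> a \<in> neg ` Sq"
      by simp
  next
    fix u v z assume "u \<in> neg ` Sq" "v \<in> neg ` Sq" "z \<in> u \<oplus> v"
    then have "neg z \<in> Sq"
      using neg_add[of z u v] Sq_add[of "neg u" "neg v" "neg z"] by auto
    then show "z \<in> neg ` Sq"
      by (metis image_eqI neg_neg)
  qed
  then obtain t where t: "t \<in> Sq" "w \<otimes> a = neg t"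
    by blast
  have "neg a \<in> a \<otimes> s \<oplus> neg t"
    using mul_add[OF s(3), of a] t(2) by (simp add: mul_assoc mul_comm[of s a])
  then have "t \<in> a \<oplus> a \<otimes> s"
    using neg_add[OF add_shift_left, of "neg a" "a \<otimes> s" "neg t"] by simp
  then have "t = a"
    using Sq_absorb[OF s(1)] by simp
  then show ?thesis
    using t(1) by simp
qed

text \<open>Where -b^2 is nonnegative, b vanishes and hence so does a; thus -a^2 lies in some s + w
  with w in the cone of -b^2. Multiplying by a^2 gives -wa^2 in a^2 + a^2 s = {a^2}, and w is fixed
  by multiplication by b^2.\<close>

lemma support_mono:
  assumes "\<And>\<sigma>. \<sigma> \<in> spec \<Longrightarrow> \<sigma> b = 0 \<Longrightarrow> \<sigma> a = 0"
  shows "a \<otimes> a \<otimes> (b \<otimes> b) = a \<otimes> a"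
proof -
  define e where "e = b \<otimes> b"
  have e: "e \<in> Sq"
    by (simp add: e_def square_in_Sq)
  note A = adjoin_preordering[OF preordering_Sq, of "neg e"]
  have "neg (a \<otimes> a) \<in> adjoin Sq (neg e)"
  proof (rule ccontr)
    assume "\<not> ?thesis"
    then obtain \<sigma> where "\<sigma> \<in> spec" "\<sigma> (neg e) \<ge> 0" "\<sigma> a \<noteq> 0"
      using positivstellensatz[OF A(1)] A(3) by blast
    then show False
      using assms[of \<sigma>] Sper_values[of \<sigma> b] by (auto simp: e_def)
  qed
  then obtain s w where s: "s \<in> Sq" "w \<in> cone Sq (neg e)" "neg (a \<otimes> a) \<in> s \<oplus> w"
    unfolding adjoin_def by blast
  \<comment> \<open>Being fixed by e passes to sums only where sums are single-valued, so the
    induction also carries that the elements are negatives of squares.\<close>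
  define S where "S = {z. neg z \<in> Sq \<and> z \<otimes> e = z}"
  have "w \<otimes> one \<in> S"
  proof (rule cone_mul_closed[OF s(2)])
    fix t assume "t \<in> Sq"
    then have "e \<otimes> t \<in> Sq" "e \<otimes> t \<otimes> e = e \<otimes> t"
      using Sq_mul[OF e] Sq_idem[OF e] mul_comm[of "e \<otimes> t" e] mul_assoc[of e e t] by simp_all
    then show "neg e \<otimes> t \<otimes> one \<in> S"
      by (simp add: S_def)
  next
    fix u v z assume uv: "u \<in> S" "v \<in> S" "z \<in> u \<oplus> v"
    then have nz: "neg u \<in> Sq" "neg v \<in> Sq" "neg z \<in> neg u \<oplus> neg v"
      using neg_add by (auto simp: S_def)
    have "neg z \<otimes> e \<in> neg u \<oplus> neg v"
      using mul_add[OF nz(3), of e] uv by (simp add: S_def)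
    then have "neg z \<otimes> e = neg z"
      using Sq_sum_unique nz by blast
    then have "z \<otimes> e = z"
      using arg_cong[of "neg z \<otimes> e" "neg z" neg] by simp
    then show "z \<in> S"
      using Sq_add[OF nz] by (simp add: S_def)
  qed
  then have w: "w \<otimes> e = w"
    by (simp add: S_def)
  have "neg (a \<otimes> a) \<in> a \<otimes> a \<otimes> s \<oplus> w \<otimes> (a \<otimes> a)"
    using mul_add[OF s(3), of "a \<otimes> a"] by (simp add: mul_assoc mul_comm[of s])
  then have "neg (w \<otimes> (a \<otimes> a)) \<in> a \<otimes> a \<oplus> a \<otimes> a \<otimes> s"
    using neg_add[OF add_shift_left, of "neg (a \<otimes> a)" "a \<otimes> a \<otimes> s" "w \<otimes> (a \<otimes> a)"] by simp
  then have aa: "neg (w \<otimes> (a \<otimes> a)) = a \<otimes> a"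
    using Sq_absorb[OF s(1)] by simp
  have "w \<otimes> (a \<otimes> a) \<otimes> e = w \<otimes> e \<otimes> (a \<otimes> a)"
    by (simp only: mul_ac)
  then have "neg (w \<otimes> (a \<otimes> a)) \<otimes> e = neg (w \<otimes> (a \<otimes> a))"
    by (simp add: w)
  then show ?thesis
    unfolding aa e_def .
qed

text \<open>The product ab is nonnegative everywhere, hence a square, so ab = a^2 b^2. Equal zero
  sets give a^2 = a^2 b^2 = b^2, and then a = a^3 = b^3 = b.\<close>

lemma Sper_separates:
  assumes eq: "\<And>\<sigma>. \<sigma> \<in> spec \<Longrightarrow> \<sigma> a = \<sigma> b"
  shows "a = b"
proof -
  have "a \<otimes> b \<in> Sq"
    by (rule nonneg_in_Sq) (simp add: eq)
  then have ab: "a \<otimes> b = a \<otimes> a \<otimes> (b \<otimes> b)"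
    using Sq_idem[of "a \<otimes> b"] by (simp add: mul_ac)
  have a: "a \<otimes> a \<otimes> (b \<otimes> b) = a \<otimes> a"
    by (rule support_mono) (simp add: eq)
  have b: "b \<otimes> b \<otimes> (a \<otimes> a) = b \<otimes> b"
    by (rule support_mono) (simp add: eq)
  have "a \<otimes> a = b \<otimes> b" "a \<otimes> b = a \<otimes> a"
    using a b ab mul_comm[of "a \<otimes> a" "b \<otimes> b"] by simp_all
  then have "a \<otimes> (a \<otimes> a) = b \<otimes> (b \<otimes> b)"
    by (metis mul_assoc mul_comm)
  then show ?thesis
    by simp
qed

text \<open>At every ordering s and t are 0 or 1, so xs and xt never have opposite signs and their
  sum there is the single value of xr. Separation of points lifts this to the multiring and makes
  \<open>repr\<close> closed under addition.\<close>

lemma Sq_multiples_add: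
  assumes "s \<in> Sq" "t \<in> Sq" "z \<in> x \<otimes> s \<oplus> x \<otimes> t"
  shows "\<exists>r\<in>Sq. z = x \<otimes> r"
proof -
  obtain r where r: "r \<in> s \<oplus> t"
    using add_nonempty by blast
  have "z = x \<otimes> r"
  proof (rule Sper_separates)
    fix \<sigma> assume \<sigma>: "\<sigma> \<in> spec"
    show "\<sigma> z = \<sigma> (x \<otimes> r)"
      using Sper_add[OF \<sigma> assms(3)] Sper_add[OF \<sigma> r] Sper_Sq[OF \<sigma> assms(1)]
        Sper_Sq[OF \<sigma> assms(2)] \<sigma>
      by (auto simp: q2_add_def split: if_splits)
  qed
  then show ?thesis
    using Sq_add assms r by blast
qed

section \<open>Elements represented by a binary form with square coefficients\<close>

definition repr :: "'a \<Rightarrow> 'a \<Rightarrow> 'a set" where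
  "repr a b = {z. \<exists>s\<in>Sq. \<exists>t\<in>Sq. z \<in> a \<otimes> s \<oplus> b \<otimes> t}"

lemma reprI: "s \<in> Sq \<Longrightarrow> t \<in> Sq \<Longrightarrow> z \<in> a \<otimes> s \<oplus> b \<otimes> t \<Longrightarrow> z \<in> repr a b"
  unfolding repr_def by blast

lemma repr_add:
  assumes "z \<in> repr a b" "w \<in> repr a b" "r \<in> z \<oplus> w"
  shows "r \<in> repr a b"
proof -
  obtain s t s' t' where st: "s \<in> Sq" "t \<in> Sq" "z \<in> a \<otimes> s \<oplus> b \<otimes> t"
    "s' \<in> Sq" "t' \<in> Sq" "w \<in> a \<otimes> s' \<oplus> b \<otimes> t'"
    using assms unfolding repr_def by blast
  then obtain u v where uv: "u \<in> a \<otimes> s \<oplus> a \<otimes> s'" "v \<in> b \<otimes> t \<oplus> b \<otimes> t'" "r \<in> u \<oplus> v"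
    using add_interchange[OF st(3,6) assms(3)] by blast
  then show ?thesis
    using Sq_multiples_add[OF st(1,4) uv(1)] Sq_multiples_add[OF st(2,5) uv(2)] reprI by blast
qed

lemma repr_left: "s \<in> Sq \<Longrightarrow> a \<otimes> s \<in> repr a b" "a \<in> repr a b"
  using reprI[of s zero "a \<otimes> s" a b] reprI[of one zero a a b] zero_one_in_Sq by auto

lemma repr_right: "s \<in> Sq \<Longrightarrow> b \<otimes> s \<in> repr a b" "b \<in> repr a b"
  using reprI[of zero s "b \<otimes> s" a b] reprI[of zero one b a b] zero_one_in_Sq by auto

lemma repr_Sq_mul:
  assumes "z \<in> repr a b" "e \<in> Sq"
  shows "z \<otimes> e \<in> repr a b"
proof -
  obtain s t where st: "s \<in> Sq" "t \<in> Sq" "z \<in> a \<otimes> s \<oplus> b \<otimes> t"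
    using assms unfolding repr_def by blast
  show ?thesis
    using mul_add[OF st(3), of e] Sq_mul[OF st(1) assms(2)] Sq_mul[OF st(2) assms(2)]
    by (auto simp: mul_assoc intro: reprI)
qed

text \<open>A product of represented elements reduces to the four products of coefficients. With R =
  \<open>repr one (a \<otimes> b)\<close> and M = \<open>repr a b\<close>, the three instances that
  follow give RR in R, MM in R and MR in M.\<close>

lemma repr_mul_repr:
  assumes z: "z \<in> repr a b" and w: "w \<in> repr c d"
    and closed: "\<And>x y r. x \<in> S \<Longrightarrow> y \<in> S \<Longrightarrow> r \<in> x \<oplus> y \<Longrightarrow> r \<in> S"
    and S: "\<And>s. s \<in> Sq \<Longrightarrow> a \<otimes> c \<otimes> s \<in> S" "\<And>s. s \<in> Sq \<Longrightarrow> b \<otimes> d \<otimes> s \<in> S"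
      "\<And>s. s \<in> Sq \<Longrightarrow> b \<otimes> c \<otimes> s \<in> S" "\<And>s. s \<in> Sq \<Longrightarrow> a \<otimes> d \<otimes> s \<in> S"
  shows "z \<otimes> w \<in> S"
proof -
  obtain s t where st: "s \<in> Sq" "t \<in> Sq" "z \<in> a \<otimes> s \<oplus> b \<otimes> t"
    using z unfolding repr_def by blast
  obtain s' t' where st': "s' \<in> Sq" "t' \<in> Sq" "w \<in> c \<otimes> s' \<oplus> d \<otimes> t'"
    using w unfolding repr_def by blast
  obtain u v where uv: "u \<in> a \<otimes> s \<otimes> (c \<otimes> s') \<oplus> b \<otimes> t \<otimes> (d \<otimes> t')"
    "v \<in> b \<otimes> t \<otimes> (c \<otimes> s') \<oplus> a \<otimes> s \<otimes> (d \<otimes> t')" "z \<otimes> w \<in> u \<oplus> v"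
    using mul_add_add[OF st(3) st'(3)] by blast
  have rearrange: "x \<otimes> s \<otimes> (y \<otimes> t) = x \<otimes> y \<otimes> (s \<otimes> t)" for x y s t
    by (simp add: mul_ac)
  have "u \<in> S"
    using closed[OF _ _ uv(1)] S(1,2) Sq_mul st st' unfolding rearrange by blast
  moreover have "v \<in> S"
    using closed[OF _ _ uv(2)] S(3,4) Sq_mul st st' unfolding rearrange by blast
  ultimately show ?thesis
    using closed uv(3) by blast
qed

lemma repr_one_mul:
  assumes "z \<in> repr one p" "w \<in> repr one p"
  shows "z \<otimes> w \<in> repr one p"
proof (rule repr_mul_repr[OF assms])
  fix s assume s: "s \<in> Sq"
  show "p \<otimes> p \<otimes> s \<in> repr one p"
    using repr_left(1)[OF Sq_mul[OF square_in_Sq s], of one] by simp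
  show "one \<otimes> one \<otimes> s \<in> repr one p"
    using repr_left(1)[OF s, of one] by simp
qed (auto intro: repr_add repr_right(1))

lemma repr_mul_self:
  assumes "z \<in> repr a b" "w \<in> repr a b"
  shows "z \<otimes> w \<in> repr one (a \<otimes> b)"
proof (rule repr_mul_repr[OF assms])
  fix s assume s: "s \<in> Sq"
  show "a \<otimes> a \<otimes> s \<in> repr one (a \<otimes> b)" "b \<otimes> b \<otimes> s \<in> repr one (a \<otimes> b)"
    using repr_left(1)[OF Sq_mul[OF square_in_Sq s], of one] by simp_all
  show "a \<otimes> b \<otimes> s \<in> repr one (a \<otimes> b)" "b \<otimes> a \<otimes> s \<in> repr one (a \<otimes> b)"
    using repr_right(1)[OF s, of "a \<otimes> b"] mul_comm[of a b] by simp_all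
qed (rule repr_add)

lemma repr_mul_one:
  assumes "z \<in> repr a b" "w \<in> repr one (a \<otimes> b)"
  shows "z \<otimes> w \<in> repr a b"
proof (rule repr_mul_repr[OF assms])
  fix s assume s: "s \<in> Sq"
  show "b \<otimes> (a \<otimes> b) \<otimes> s \<in> repr a b"
    using repr_left(1)[OF Sq_mul[OF square_in_Sq[of b] s], of a] by (simp add: mul_ac)
  show "a \<otimes> (a \<otimes> b) \<otimes> s \<in> repr a b"
    using repr_right(1)[OF Sq_mul[OF square_in_Sq[of a] s], of b] by (simp add: mul_ac)
qed (use repr_left(1) repr_right(1) in \<open>auto intro: repr_add\<close>)

text \<open>This is the preordering generated by -a and -b. In the notation R, M, closure under
  products is (p - q)(p' - q') = (pp' + qq') - (qp' + pq'), read as an inclusion.\<close>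

lemma preordering_repr_diff:
  "preordering {z. \<exists>p\<in>repr one (a \<otimes> b). \<exists>q\<in>repr a b. z \<in> p \<oplus> neg q}"
    (is "preordering ?U")
  unfolding preordering_def
proof (intro conjI allI ballI subsetI)
  show "x \<otimes> x \<in> ?U" for x
    using repr_left(1)[OF square_in_Sq[of x], of one "a \<otimes> b"]
      repr_left(1)[OF zero_one_in_Sq(1), of a b] by force
  fix z z' assume "z \<in> ?U" "z' \<in> ?U"
  then obtain p q p' q' where z: "p \<in> repr one (a \<otimes> b)" "q \<in> repr a b" "z \<in> p \<oplus> neg q"
    and z': "p' \<in> repr one (a \<otimes> b)" "q' \<in> repr a b" "z' \<in> p' \<oplus> neg q'"
    by blast
  {
    obtain u v where uv: "u \<in> p \<otimes> p' \<oplus> neg q \<otimes> neg q'" "v \<in> neg q \<otimes> p' \<oplus> p \<otimes> neg q'"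
      "z \<otimes> z' \<in> u \<oplus> v"
      using mul_add_add[OF z(3) z'(3)] by blast
    have "u \<in> repr one (a \<otimes> b)"
      using repr_add[OF repr_one_mul[OF z(1) z'(1)] repr_mul_self[OF z(2) z'(2)]] uv(1) by simp
    moreover have "neg v \<in> repr a b"
      using repr_add[OF repr_mul_one[OF z(2) z'(1)] repr_mul_one[OF z'(2) z(1)]] neg_add[OF uv(2)]
      by (simp add: mul_comm)
    ultimately show "z \<otimes> z' \<in> ?U"
      using uv(3) neg_neg[of v] by force
  next
    fix r assume "r \<in> z \<oplus> z'"
    then obtain u v where uv: "u \<in> p \<oplus> p'" "v \<in> neg q \<oplus> neg q'" "r \<in> u \<oplus> v"
      using add_interchange[OF z(3) z'(3)] by blast
    have "u \<in> repr one (a \<otimes> b)" "neg v \<in> repr a b"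
      using repr_add[OF z(1) z'(1) uv(1)] repr_add[OF z(2) z'(2)] neg_add[OF uv(2)] by simp_all
    then show "r \<in> ?U"
      using uv(3) neg_neg[of v] by force
  }
qed

text \<open>With \<open>\<alpha> = ac\<close>, \<open>\<beta> = bc\<close> and \<open>e = c\<^sup>2\<close>, the Positivstellensatz yields an \<open>N\<close> represented by
  \<open>\<alpha>, \<beta>\<close> with \<open>N \<in> e + \<alpha>\<beta>v\<close>. It may vanish at points where \<open>\<alpha>\<beta> < 0\<close>; the element
  \<open>m \<in> \<alpha>\<^sup>2 + \<alpha>N\<close> is represented by \<open>\<alpha>, \<beta>\<close> as well and equals 1 at those points, so that \<open>m\<^sup>2 + N\<^sup>2 = e\<close>.\<close>

lemma mem_repr_of_Sper:
  assumes pos: "\<And>\<sigma>. \<sigma> \<in> spec \<Longrightarrow> \<sigma> c \<noteq> 0 \<Longrightarrow> \<sigma> a * \<sigma> c > 0 \<or> \<sigma> b * \<sigma> c > 0"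
  shows "c \<in> repr a b"
proof -
  define \<alpha> \<beta> e where "\<alpha> = a \<otimes> c" and "\<beta> = b \<otimes> c" and "e = c \<otimes> c"
  have e: "e \<in> Sq"
    by (simp add: e_def square_in_Sq)
  have ae: "\<alpha> \<otimes> e = \<alpha>"
    by (simp add: \<alpha>_def e_def mul_assoc)
  let ?U = "{z. \<exists>p\<in>repr one (\<alpha> \<otimes> \<beta>). \<exists>q\<in>repr \<alpha> \<beta>. z \<in> p \<oplus> neg q}"
  have zero_repr: "zero \<in> repr one (\<alpha> \<otimes> \<beta>)"
    using repr_left(1)[OF zero_one_in_Sq(1), of one] by simp
  have U: "neg x \<in> ?U" if "x \<in> repr \<alpha> \<beta>" for x
    using zero_repr that by (intro CollectI bexI[of _ zero] bexI[of _ x]) simp_all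
  have "neg (c \<otimes> c) \<in> ?U"
  proof (rule ccontr)
    assume "\<not> ?thesis"
    then obtain \<sigma> where \<sigma>: "\<sigma> \<in> spec" "\<forall>t\<in>?U. \<sigma> t \<ge> 0" "\<sigma> c \<noteq> 0"
      using positivstellensatz[OF preordering_repr_diff] by blast
    have "\<sigma> (neg \<alpha>) \<ge> 0" "\<sigma> (neg \<beta>) \<ge> 0"
      using bspec[OF \<sigma>(2) U] repr_left(2)[of \<alpha> \<beta>] repr_right(2)[of \<beta> \<alpha>] by blast+
    then show False
      using pos[OF \<sigma>(1,3)] \<sigma>(1) by (simp add: \<alpha>_def \<beta>_def)
  qed
  then obtain p q where p: "p \<in> repr one (\<alpha> \<otimes> \<beta>)" and q: "q \<in> repr \<alpha> \<beta>" and "neg e \<in> p \<oplus> neg q"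
    by (auto simp: e_def)
  then have qe: "q \<in> e \<oplus> p"
    using neg_add[OF add_shift_left, of "neg e" p "neg q"] by simp
  obtain s v where sv: "s \<in> Sq" "v \<in> Sq" "p \<in> s \<oplus> \<alpha> \<otimes> \<beta> \<otimes> v"
    using p unfolding repr_def by auto
  obtain g where g: "g \<in> e \<oplus> s" "q \<in> g \<oplus> \<alpha> \<otimes> \<beta> \<otimes> v"
    using add_assoc_left[OF sv(3) qe] by blast
  define N where "N = q \<otimes> e"
  \<comment> \<open>Multiplication by e removes the square s from q in (e + s) + \<alpha>\<beta>v,
    since e + es = {e}.\<close>
  have "g \<otimes> e = e"
    using mul_add[OF g(1), of e] Sq_absorb[OF sv(1), of "g \<otimes> e" e]
    by (simp add: Sq_idem[OF e] mul_comm)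
  moreover have "\<alpha> \<otimes> \<beta> \<otimes> v \<otimes> e = \<alpha> \<otimes> e \<otimes> (\<beta> \<otimes> v)"
    by (simp only: mul_ac)
  ultimately have N: "N \<in> e \<oplus> \<alpha> \<otimes> \<beta> \<otimes> v"
    using mul_add[OF g(2), of e] by (simp add: ae N_def mul_assoc)
  have NM: "N \<in> repr \<alpha> \<beta>"
    unfolding N_def using repr_Sq_mul[OF q e] .
  have NR: "N \<in> repr one (\<alpha> \<otimes> \<beta>)"
    using reprI[OF e sv(2), of N one] N by simp
  have aNR: "\<alpha> \<otimes> N \<in> repr one (\<alpha> \<otimes> \<beta>)"
    using repr_mul_self[OF repr_left(2) NM] .
  \<comment> \<open>The element m is to lie both in \<alpha> + \<alpha>^2 \<beta>v, which is
    contained in \<open>repr \<alpha> \<beta>\<close>, and in \<alpha>^2 + \<alpha>N, which fixes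
    its value where N vanishes. A common element comes from \<alpha>^2 in \<alpha> - \<alpha>, with
    -\<alpha> rewritten by means of N.\<close>
  have "neg \<alpha> \<in> \<alpha> \<otimes> \<alpha> \<otimes> \<beta> \<otimes> v \<oplus> neg (\<alpha> \<otimes> N)"
    using neg_add[OF mul_add_left[OF add_shift[OF N], of \<alpha>]] ae by (simp add: mul_assoc add_comm)
  from add_assoc_left[OF this square_in_diff_self]
  obtain m where m: "m \<in> \<alpha> \<oplus> \<alpha> \<otimes> \<alpha> \<otimes> \<beta> \<otimes> v" "\<alpha> \<otimes> \<alpha> \<in> m \<oplus> neg (\<alpha> \<otimes> N)"
    by blast
  have m2: "m \<in> \<alpha> \<otimes> \<alpha> \<oplus> \<alpha> \<otimes> N"
    using m(2) add_shift_iff by blast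
  have "\<alpha> \<otimes> \<alpha> \<otimes> \<beta> \<otimes> v = \<beta> \<otimes> (\<alpha> \<otimes> \<alpha> \<otimes> v)"
    by (simp only: mul_ac)
  then have mM: "m \<in> repr \<alpha> \<beta>"
    using reprI[OF zero_one_in_Sq(2) Sq_mul[OF square_in_Sq sv(2)], of m \<alpha> \<beta> \<alpha>] m(1) by simp
  have "\<alpha> \<otimes> \<alpha> \<in> repr one (\<alpha> \<otimes> \<beta>)"
    using repr_left(1)[OF square_in_Sq, of one] by simp
  then have mR: "m \<in> repr one (\<alpha> \<otimes> \<beta>)"
    using repr_add aNR m2 by blast
  obtain z where z: "z \<in> m \<otimes> m \<oplus> N \<otimes> N"
    using add_nonempty by blast
  have "z = e"
  proof (rule Sper_separates)
    fix \<sigma> assume \<sigma>: "\<sigma> \<in> spec"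
    have vals: "\<sigma> c = -1 \<or> \<sigma> c = 0 \<or> \<sigma> c = 1" "\<sigma> N = -1 \<or> \<sigma> N = 0 \<or> \<sigma> N = 1"
      "\<sigma> m = -1 \<or> \<sigma> m = 0 \<or> \<sigma> m = 1" "\<sigma> \<alpha> = -1 \<or> \<sigma> \<alpha> = 0 \<or> \<sigma> \<alpha> = 1"
      using Sper_values[OF \<sigma>] by blast+
    \<comment> \<open>Where c is nonzero and N vanishes, \<alpha>\<beta>v is -1, so \<alpha> is
      nonzero and m = 1. Where c vanishes, so do \<alpha>, N and m.\<close>
    have "\<sigma> z \<in> q2_add (\<sigma> m * \<sigma> m) (\<sigma> N * \<sigma> N)" "\<sigma> m \<in> q2_add (\<sigma> \<alpha> * \<sigma> \<alpha>) (\<sigma> \<alpha> * \<sigma> N)"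
      "\<sigma> N \<in> q2_add (\<sigma> c * \<sigma> c) (\<sigma> \<alpha> * \<sigma> \<beta> * \<sigma> v)"
      using Sper_add[OF \<sigma> z] Sper_add[OF \<sigma> N] Sper_add[OF \<sigma> m2]
      by (simp_all add: \<sigma> e_def)
    moreover have "\<sigma> c = 0 \<Longrightarrow> \<sigma> \<alpha> = 0"
      using \<sigma> by (simp add: \<alpha>_def)
    ultimately have "\<sigma> z = \<sigma> c * \<sigma> c"
      using vals by (elim disjE) (simp_all add: q2_add_def)
    then show "\<sigma> z = \<sigma> e"
      by (simp add: \<sigma> e_def)
  qed
  \<comment> \<open>Both m and N lie in \<open>repr \<alpha> \<beta>\<close> and in
    \<open>repr one (\<alpha> \<otimes> \<beta>)\<close>, so their squares lie in the former.
    Multiplying e by c afterwards returns c, as c^3 = c.\<close>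
  then have "e \<in> repr \<alpha> \<beta>"
    using repr_add[OF repr_mul_one[OF mM mR] repr_mul_one[OF NM NR] z] by simp
  then obtain s t where st: "s \<in> Sq" "t \<in> Sq" "e \<in> \<alpha> \<otimes> s \<oplus> \<beta> \<otimes> t"
    unfolding repr_def by blast
  have "\<alpha> \<otimes> s \<otimes> c = a \<otimes> (e \<otimes> s)" "\<beta> \<otimes> t \<otimes> c = b \<otimes> (e \<otimes> t)"
    unfolding \<alpha>_def \<beta>_def e_def by (simp_all only: mul_ac)
  then have "e \<otimes> c \<in> a \<otimes> (e \<otimes> s) \<oplus> b \<otimes> (e \<otimes> t)"
    using mul_add[OF st(3), of c] by simp
  then show ?thesis
    using reprI[OF Sq_mul[OF e st(1)] Sq_mul[OF e st(2)]] by (simp add: e_def mul_assoc)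
qed

theorem add_iff_Sper: "c \<in> a \<oplus> b \<longleftrightarrow> (\<forall>\<sigma>\<in>spec. \<sigma> c \<in> q2_add (\<sigma> a) (\<sigma> b))"
proof
  assume "c \<in> a \<oplus> b"
  then show "\<forall>\<sigma>\<in>spec. \<sigma> c \<in> q2_add (\<sigma> a) (\<sigma> b)"
    using Sper_add by blast
next
  assume H: "\<forall>\<sigma>\<in>spec. \<sigma> c \<in> q2_add (\<sigma> a) (\<sigma> b)"
  \<comment> \<open>In Q_2 the relation c in a + b is equivalent to a in c - b and to b in c - a;
    each form yields one instance of the hypothesis of \<open>mem_repr_of_Sper\<close>.\<close>
  have local: "(\<sigma> c \<noteq> 0 \<longrightarrow> \<sigma> a * \<sigma> c > 0 \<or> \<sigma> b * \<sigma> c > 0) \<and>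
      (\<sigma> a \<noteq> 0 \<longrightarrow> \<sigma> c * \<sigma> a > 0 \<or> - \<sigma> b * \<sigma> a > 0) \<and>
      (\<sigma> b \<noteq> 0 \<longrightarrow> \<sigma> c * \<sigma> b > 0 \<or> - \<sigma> a * \<sigma> b > 0)" if "\<sigma> \<in> spec" for \<sigma>
    using bspec[OF H that] Sper_values[OF that, of a] Sper_values[OF that, of b]
      Sper_values[OF that, of c]
    by (auto simp: q2_add_def)
  have "c \<in> repr a b"
    using local by (intro mem_repr_of_Sper) simp
  then obtain s t where c: "s \<in> Sq" "t \<in> Sq" "c \<in> a \<otimes> s \<oplus> b \<otimes> t"
    unfolding repr_def by blast
  have "a \<in> repr c (neg b)"
    using local by (intro mem_repr_of_Sper) simp
  then obtain s' t' where a: "s' \<in> Sq" "t' \<in> Sq" "a \<in> c \<otimes> s' \<oplus> neg (b \<otimes> t')"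
    unfolding repr_def by auto
  have "b \<in> repr c (neg a)"
    using local by (intro mem_repr_of_Sper) simp
  then obtain s'' t'' where b: "s'' \<in> Sq" "t'' \<in> Sq" "b \<in> c \<otimes> s'' \<oplus> neg (a \<otimes> t'')"
    unfolding repr_def by auto
  \<comment> \<open>Adding c in as + bt to cs' in a + bt' keeps c on the left and absorbs the
    coefficient of a. The coefficient w of b that remains is absorbed in the same way by the
    relation for b.\<close>
  have "c \<in> c \<oplus> c \<otimes> s'" "c \<otimes> s' \<in> a \<oplus> b \<otimes> t'"
    using Sq_absorb[OF a(1)] a(3) add_shift_iff by blast+
  then obtain x y where xy: "x \<in> a \<otimes> s \<oplus> a" "y \<in> b \<otimes> t \<oplus> b \<otimes> t'" "c \<in> x \<oplus> y"
    using add_interchange[OF c(3)] by blast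
  have "x = a"
    using Sq_absorb[OF c(1), of x a] xy(1) by (simp add: add_comm)
  obtain w where w: "w \<in> Sq" "y = b \<otimes> w"
    using Sq_multiples_add[OF c(2) a(2) xy(2)] by blast
  have c': "c \<in> a \<oplus> b \<otimes> w"
    using xy(3) w \<open>x = a\<close> by simp
  have "c \<in> c \<oplus> c \<otimes> s''" "c \<otimes> s'' \<in> a \<otimes> t'' \<oplus> b"
    using Sq_absorb[OF b(1)] b(3) add_shift_iff[of b] by (auto simp: add_comm[of _ b])
  then obtain x y where xy: "x \<in> a \<oplus> a \<otimes> t''" "y \<in> b \<otimes> w \<oplus> b" "c \<in> x \<oplus> y"
    using add_interchange[OF c'] by blast
  have "x = a" "y = b"
    using Sq_absorb[OF b(2), of x a] Sq_absorb[OF w(1), of y b] xy(1,2) by (simp_all add: add_comm)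
  then show "c \<in> a \<oplus> b"
    using xy(3) by simp
qed

section \<open>The abstract real spectrum\<close>

lemma Sper_nonempty: "spec \<noteq> {}"
proof -
  have "neg (one \<otimes> one) \<notin> Sq"
  proof
    assume *: "neg (one \<otimes> one) \<in> Sq"
    \<comment> \<open>If -1 were a square, then 1 - 1, which contains 0, would collapse to
      {1}.\<close>
    have "zero \<in> one \<oplus> one \<otimes> neg (one \<otimes> one)"
      using zero_in_add_neg[of one] by simp
    then have "zero = one"
      using Sq_absorb[OF *] by blast
    then show False
      using rr by (simp add: real_reduced_def)
  qed
  then show ?thesis
    using positivstellensatz[OF preordering_Sq] by blast
qed

abbreviation "ev \<equiv> hat add mul neg zero one"

lemma hat_apply: "\<sigma> \<in> spec \<Longrightarrow> ev a \<sigma> = \<sigma> a"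
  by (simp add: hat_def)

lemma hat_eqI: "f \<in> extensional spec \<Longrightarrow> (\<And>\<sigma>. \<sigma> \<in> spec \<Longrightarrow> f \<sigma> = \<sigma> a) \<Longrightarrow> f = ev a"
  by (rule extensionalityI[of _ spec]) (auto simp: hat_def)

lemma hat_mult: "ars_mult spec (ev a) (ev b) = ev (a \<otimes> b)"
  by (rule hat_eqI) (auto simp: ars_mult_def hat_apply)

lemma hat_neg: "ars_neg spec (ev a) = ev (neg a)"
  by (rule hat_eqI) (auto simp: ars_neg_def hat_apply)

lemma hat_const: "ars_const spec 0 = ev zero" "ars_const spec 1 = ev one"
  "ars_const spec (-1) = ev (neg one)"
  by (rule hat_eqI; auto simp: ars_const_def)+

text \<open>On {-1, 0, 1} the condition defining \<open>ars_Dt\<close> is membership in the sum of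
  Q_2, so \<open>add_iff_Sper\<close> applies. Under this dictionary (AX3) is
  \<open>add_assoc_left\<close>.\<close>

lemma hat_Dt_iff: "ev c \<in> ars_Dt spec (range ev) (ev a) (ev b) \<longleftrightarrow> c \<in> a \<oplus> b"
proof -
  have "(\<sigma> a * \<sigma> c > 0 \<or> \<sigma> b * \<sigma> c > 0 \<or> (\<sigma> c = 0 \<and> \<sigma> b = - \<sigma> a)) \<longleftrightarrow>
      \<sigma> c \<in> q2_add (\<sigma> a) (\<sigma> b)" if "\<sigma> \<in> spec" for \<sigma>
    using Sper_values[OF that, of a] Sper_values[OF that, of b] Sper_values[OF that, of c]
    by (auto simp: q2_add_def)
  then show ?thesis
    by (simp add: add_iff_Sper ars_Dt_def hat_apply)
qed

lemma add_subset_hat_D: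
  assumes "c \<in> a \<oplus> b"
  shows "ev c \<in> ars_D spec (range ev) (ev a) (ev b)"
proof -
  have "\<sigma> a * \<sigma> c > 0 \<or> \<sigma> b * \<sigma> c > 0 \<or> \<sigma> c = 0" if "\<sigma> \<in> spec" for \<sigma>
    using Sper_values[OF that, of a] Sper_values[OF that, of b] Sper_values[OF that, of c]
      Sper_add[OF that assms]
    by (auto simp: q2_add_def split: if_splits)
  then show ?thesis
    by (simp add: ars_D_def hat_apply)
qed

text \<open>The preimage of \<open>P\<close> under \<open>ev\<close> satisfies the hypotheses of
  \<open>ordering_morphism\<close>; its closure under sums holds because sums map into
  \<open>ars_D\<close>. The resulting morphism is the required point.\<close>

lemma hat_AX2:
  assumes P: "P \<subseteq> range ev" "\<forall>a\<in>P. \<forall>b\<in>P. ars_mult spec a b \<in> P"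
    "P \<union> ars_neg spec ` P = range ev" "ars_const spec (-1) \<notin> P"
    "\<forall>a\<in>P. \<forall>b\<in>P. ars_D spec (range ev) a b \<subseteq> P"
    "\<forall>a\<in>range ev. \<forall>b\<in>range ev. ars_mult spec a b \<in> P \<inter> ars_neg spec ` P \<longrightarrow>
      a \<in> P \<inter> ars_neg spec ` P \<or> b \<in> P \<inter> ars_neg spec ` P"
  shows "\<exists>\<sigma>\<in>spec. P = {a \<in> range ev. a \<sigma> \<ge> 0}"
proof -
  have neg_image: "ev a \<in> ars_neg spec ` P \<longleftrightarrow> ev (neg a) \<in> P" for a
  proof
    assume "ev a \<in> ars_neg spec ` P"
    then obtain f where f: "f \<in> P" "ev a = ars_neg spec f"
      by (rule imageE)
    then obtain x where "f = ev x"
      using P(1) by blast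
    then have "ev (neg a) = f"
      by (simp add: f(2) hat_neg flip: hat_neg[of a])
    then show "ev (neg a) \<in> P"
      using f(1) by simp
  next
    assume "ev (neg a) \<in> P"
    then show "ev a \<in> ars_neg spec ` P"
      by (intro image_eqI[of _ _ "ev (neg a)"]) (simp_all add: hat_neg)
  qed
  have "\<exists>\<sigma>\<in>spec. \<forall>a. \<sigma> a \<ge> 0 \<longleftrightarrow> a \<in> {a. ev a \<in> P}"
  proof (rule ordering_morphism)
    fix s t assume st: "s \<in> {a. ev a \<in> P}" "t \<in> {a. ev a \<in> P}"
    then show "s \<otimes> t \<in> {a. ev a \<in> P}"
      using bspec[OF bspec[OF P(2)], of "ev s" "ev t"] by (simp add: hat_mult)
    show "s \<oplus> t \<subseteq> {a. ev a \<in> P}"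
    proof
      fix c assume "c \<in> s \<oplus> t"
      then have "ev c \<in> ars_D spec (range ev) (ev s) (ev t)"
        by (rule add_subset_hat_D)
      then show "c \<in> {a. ev a \<in> P}"
        using st P(5) by blast
    qed
  next
    fix x
    have "ev x \<in> P \<union> ars_neg spec ` P"
      unfolding P(3) by simp
    then show "x \<in> {a. ev a \<in> P} \<or> neg x \<in> {a. ev a \<in> P}"
      by (simp add: neg_image)
  next
    show "neg one \<notin> {a. ev a \<in> P}"
      using P(4) by (simp add: hat_const)
  next
    fix x y assume "x \<otimes> y \<in> {a. ev a \<in> P}" "neg (x \<otimes> y) \<in> {a. ev a \<in> P}"
    then have "ars_mult spec (ev x) (ev y) \<in> P \<inter> ars_neg spec ` P"
      by (simp add: hat_mult neg_image)
    then have "ev x \<in> P \<inter> ars_neg spec ` P \<or> ev y \<in> P \<inter> ars_neg spec ` P"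
      using P(6) by blast
    then show "x \<in> {a. ev a \<in> P} \<and> neg x \<in> {a. ev a \<in> P} \<or>
        y \<in> {a. ev a \<in> P} \<and> neg y \<in> {a. ev a \<in> P}"
      by (simp add: neg_image)
  qed
  then obtain \<sigma> where \<sigma>: "\<sigma> \<in> spec" "\<And>a. \<sigma> a \<ge> 0 \<longleftrightarrow> ev a \<in> P"
    by blast
  have "P = {a \<in> range ev. a \<sigma> \<ge> 0}"
  proof (rule set_eqI)
    fix f
    show "f \<in> P \<longleftrightarrow> f \<in> {a \<in> range ev. a \<sigma> \<ge> 0}"
    proof (cases "f \<in> range ev")
      case True
      then show ?thesis
        by (auto simp: hat_apply[OF \<sigma>(1)] \<sigma>(2))
    next
      case False
      then show ?thesis
        using P(1) by blast
    qed
  qed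
  then show ?thesis
    using \<sigma>(1) by blast
qed

lemma hat_AX3:
  assumes "\<exists>q\<in>ars_Dt spec (range ev) (ev b) (ev c). ev p \<in> ars_Dt spec (range ev) (ev a) q"
  shows "\<exists>r\<in>ars_Dt spec (range ev) (ev a) (ev b). ev p \<in> ars_Dt spec (range ev) r (ev c)"
proof -
  obtain f where f: "f \<in> ars_Dt spec (range ev) (ev b) (ev c)"
    "ev p \<in> ars_Dt spec (range ev) (ev a) f"
    using assms by blast
  then obtain q where "f = ev q"
    unfolding ars_Dt_def by blast
  then have "q \<in> b \<oplus> c" "p \<in> a \<oplus> q"
    using f hat_Dt_iff by simp_all
  then obtain r where "r \<in> a \<oplus> b" "p \<in> r \<oplus> c"
    using add_assoc_left by blast
  then show ?thesis
    using hat_Dt_iff[of r] hat_Dt_iff[of p r c] by blast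
qed

lemma Sper_ARS: "ARS spec (range ev)"
  unfolding ARS_def
proof (intro conjI)
  show "range ev \<subseteq> spec \<rightarrow>\<^sub>E {-1, 0, 1}"
  proof
    fix f assume "f \<in> range ev"
    then obtain a where "f = ev a"
      by blast
    then show "f \<in> spec \<rightarrow>\<^sub>E {-1, 0, 1}"
      using Sper_values[of _ a] by (auto simp: hat_def)
  qed
  show "\<forall>x\<in>spec. \<forall>y\<in>spec. x \<noteq> y \<longrightarrow> (\<exists>g\<in>range ev. g x \<noteq> g y)"
  proof (intro ballI impI)
    fix x y assume xy: "x \<in> spec" "y \<in> spec" "x \<noteq> y"
    then obtain a where "x a \<noteq> y a"
      by (auto simp: fun_eq_iff)
    then show "\<exists>g\<in>range ev. g x \<noteq> g y"
      using xy by (intro bexI[of _ "ev a"]) (simp_all add: hat_apply)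
  qed
  show "\<forall>a\<in>range ev. \<forall>b\<in>range ev. \<forall>c\<in>range ev. \<forall>p\<in>range ev.
       (\<exists>q\<in>ars_Dt spec (range ev) b c. p \<in> ars_Dt spec (range ev) a q) \<longrightarrow>
       (\<exists>r\<in>ars_Dt spec (range ev) a b. p \<in> ars_Dt spec (range ev) r c)"
  proof (intro ballI impI, elim rangeE)
    fix a b c p x y z w
    assume H: "\<exists>q\<in>ars_Dt spec (range ev) b c. p \<in> ars_Dt spec (range ev) a q"
      and eqs: "a = ev x" "b = ev y" "c = ev z" "p = ev w"
    show "\<exists>r\<in>ars_Dt spec (range ev) a b. p \<in> ars_Dt spec (range ev) r c"
      using H unfolding eqs by (rule hat_AX3)
  qed
  show "\<forall>P. P \<subseteq> range ev \<and> ars_const spec 1 \<in> P \<and> (\<forall>a\<in>P. \<forall>b\<in>P. ars_mult spec a b \<in> P) \<and>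
         P \<union> ars_neg spec ` P = range ev \<and> ars_const spec (-1) \<notin> P \<and>
         (\<forall>a\<in>P. \<forall>b\<in>P. ars_D spec (range ev) a b \<subseteq> P) \<and>
         (\<forall>a\<in>range ev. \<forall>b\<in>range ev. ars_mult spec a b \<in> P \<inter> ars_neg spec ` P \<longrightarrow>
              a \<in> P \<inter> ars_neg spec ` P \<or> b \<in> P \<inter> ars_neg spec ` P)
       \<longrightarrow> (\<exists>x\<in>spec. P = {a\<in>range ev. a x \<ge> 0})"
    by (intro allI impI, elim conjE) (rule hat_AX2)
qed (auto simp: Sper_nonempty hat_mult hat_const)

end

theorem theorem4p5:
  fixes add :: "'a \<Rightarrow> 'a \<Rightarrow> 'a set" and mul :: "'a \<Rightarrow> 'a \<Rightarrow> 'a"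
    and neg :: "'a \<Rightarrow> 'a" and zero one :: 'a
  assumes "real_reduced add mul neg zero one"
  shows "ARS (Sper add mul neg zero one) (range (hat add mul neg zero one))"
proof -
  interpret real_reduced_multiring add mul neg zero one
    using assms by unfold_locales
  show ?thesis
    by (rule Sper_ARS)
qed

end
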